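(* Let $\mathcal{A}$ be an algorithm that is optimal for the backward MAMP problem with cost $\tilde J=\sum_i\tilde J_i$, and let $(x(t),u(t),t_f)$ be the solution obtained by applying the simultaneous-arrival algorithm $\mathrm{SA}(\mathcal{A})$ (all defined in the context) to an instance in which all agents are at rest at their initial states. If $$\int_{0}^{t} l(x,\mathbf{0})\,d\tau = 0$$ for all states $x$ and all $t\in[0,t_f]$ (i.e. waiting for time $t$ has zero cost), then $(x(t),u(t),t_f)$ is an optimal solution of the MAMP problem with simultaneous arrival, i.e. it minimizes $J$ among all feasible solutions of that problem.
   Context: **Instance.** There are $K\ge 1$ agents in a workspace $W\subset\mathbb{R}^2$ with obstacle region $O\subset W$. Agent $i$ has dynamics $\dot x_i(t)=f_i(x_i(t),u_i(t))$, control set $\mathcal{U}_i\subset\mathbb{R}^{m_i}$, and occupies the region $R_i(x_i)\subset\mathbb{R}^2$ when in state $x_i\in\mathbb{R}^{n_i}$. Its state space is $\mathcal{X}_i=\{x_i\in\mathbb{R}^{n_i} : R_i(x_i)\subset W\}$ and its free space is $\mathcal{X}_{i,\mathrm{free}}=\{x_i\in\mathcal{X}_i : R_i(x_i)\cap O=\emptyset\}$. Each agent has an initial state $x_{s,i}$ and a final state $x_{f,i}$. All agents are at rest at their initial states: $\mathbf 0\in\mathcal{U}_i$ and $f_i(x_{s,i},\mathbf 0)=0$, so agent $i$ can remain ("wait") at $x_{s,i}$ with control $\mathbf 0$ for any duration. A running cost $l(x,u)\ge 0$, defined on state-control pairs, is given; in the integral $\int_0^t l(x,\mathbf 0)\,d\tau$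 the state $x$ is held constant. **Motion primitives.** A set $\mathcal{P}$ of feasible motion primitives is given for each agent: each primitive is a pair $(x,u)$ of functions on an interval $[0,t_p]$ satisfying the agent's dynamics with controls in $\mathcal{U}_i$ (all translated copies that may be used are included in the set). An admissible forward trajectory of agent $i$ of duration $T\ge 0$ is a wait at $x_{s,i}$ of some duration $\tau\ge0$ followed by a finite (possibly empty) concatenation of primitives with matching endpoint states, of total duration $T$. **MAMP problem with simultaneous arrival.** A feasible solution consists of a common final time $t_f\ge 0$ and, for each $i$, an admissible forward trajectory $(x_i,u_i)$ on $[0,t_f]$ with $x_i(0)=x_{s,i}$, $x_i(t_f)=x_{f,i}$, $x_i(t)\in\mathcal{X}_{i,\mathrm{free}}$ for all $t\in[0,t_f]$, and $R_i(x_i(t))\cap R_j(x_j(t))=\emptyset$ for all $i\ne j$ and $t\in[0,t_f]$. Its cost is $J=\sum_{i=1}^K J_i$ with $J_i=\int_0^{t_f} l(x_i(t),u_i(t))\,dt$. The optimal problem is to minimize $J$ over feasible solutions. **Backward MAMP problem.** Here the initial states are $x_{f,i}$, the final states are $x_{s,i}$, and the primitives are the time reversals of the primitives in $\mathcal{P}$. A feasible solution consists, for each $i$, of a duration $t_{f,i}\ge0$ (not necessarily equal for different agents) and a pair $(x_{\mathrm{rev},i},u_{\mathrm{rev},i})$ on $[0,t_{f,i}]$ that is the time reversal $t\mapsto (x_i(t_{f,i}-t),u_i(t_{f,i}-t))$ of an admissible forward trajectory of duration $t_{f,i}$, with $x_{\mathrm{rev},i}(0)=x_{f,i}$, $x_{\mathrm{rev},i}(t_{f,i})=x_{s,i}$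 and $x_{\mathrm{rev},i}(t)\in\mathcal{X}_{i,\mathrm{free}}$. After time $t_{f,i}$ agent $i$ remains at $x_{s,i}$, i.e. $x_{\mathrm{rev},i}(t)=x_{s,i}$ for $t>t_{f,i}$, and with this extension $R_i(x_{\mathrm{rev},i}(t))\cap R_j(x_{\mathrm{rev},j}(t))=\emptyset$ for all $i\neq j$ and all $t\ge0$. Its cost is $\tilde J=\sum_{i=1}^K\tilde J_i$ with $\tilde J_i=\int_0^{t_{f,i}} l(x_{\mathrm{rev},i}(t),u_{\mathrm{rev},i}(t))\,dt$. **Optimal algorithm.** $\mathcal{A}$ is optimal for the backward problem if the solution it returns is a feasible solution of the backward problem minimizing $\tilde J$ among all feasible solutions of the backward problem. **Algorithm $\mathrm{SA}(\mathcal{A})$.** Given an instance: (1) run $\mathcal{A}$ on the backward MAMP problem to obtain $\{(x_{\mathrm{rev},i},u_{\mathrm{rev},i},t_{f,i})\}_{i=1}^K$; (2) set $t_f=\max_i t_{f,i}$; (3) for each $i$ and $t\in[0,t_f]$, set $x_i(t)=x_{\mathrm{rev},i}(t_f-t)$ and $u_i(t)=u_{\mathrm{rev},i}(t_f-t)$ if $t\ge t_f-t_{f,i}$, and $x_i(t)=x_{s,i}$, $u_i(t)=\mathbf 0$ otherwise; (4) return $(x_i,u_i)_{i=1}^K$ and $t_f$. *)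

theory Defs
  imports "HOL-Analysis.Analysis" "Jordan_Normal_Form.Matrix"
begin

(* The agents have state and control spaces of different dimensions, so points of R^n are
   vectors in carrier_vec n.  The name vec is qualified because the index-type vectors of
   HOL-Analysis, used for the planar workspace, have a type of the same base name. *)
type_synonym rvec = "real Matrix.vec"

(* A pair of functions on the interval [0, dur].  Values outside that interval are irrelevant. *)
record trajectory =
  dur :: real
  st :: "real \<Rightarrow> rvec"
  ct :: "real \<Rightarrow> rvec"

definition same_trajectory :: "trajectory \<Rightarrow> trajectory \<Rightarrow> bool" where
  "same_trajectory p q \<longleftrightarrow>
     dur p = dur q \<and> (\<forall>t\<in>{0..dur p}. st p t = st q t \<and> ct p t = ct q t)"

definition time_reversal :: "trajectory \<Rightarrow> trajectory" where
  "time_reversal p =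
     \<lparr>dur = dur p, st = (\<lambda>t. st p (dur p - t)), ct = (\<lambda>t. ct p (dur p - t))\<rparr>"

(* At the junction time the control is that of the second piece; the states of the two pieces
   agree there whenever concatenation is used. *)
definition concatenate :: "trajectory \<Rightarrow> trajectory \<Rightarrow> trajectory" where
  "concatenate p q =
     \<lparr>dur = dur p + dur q,
      st = (\<lambda>t. if t < dur p then st p t else st q (t - dur p)),
      ct = (\<lambda>t. if t < dur p then ct p t else ct q (t - dur p))\<rparr>"

(* The agents are those i with i < num_agents.  A single running cost serves all agents, as a
   vector carries its own dimension. *)
record mamp =
  num_agents :: nat
  workspace :: "(real^2) set"
  obstacles :: "(real^2) set"
  state_dim :: "nat \<Rightarrow> nat"
  control_dim :: "nat \<Rightarrow> nat"
  dynamics :: "nat \<Rightarrow> rvec \<Rightarrow> rvec \<Rightarrow> rvec"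
  control_set :: "nat \<Rightarrow> rvec set"
  region :: "nat \<Rightarrow> rvec \<Rightarrow> (real^2) set"
  init_state :: "nat \<Rightarrow> rvec"
  final_state :: "nat \<Rightarrow> rvec"
  primitives :: "nat \<Rightarrow> trajectory set"
  running_cost :: "rvec \<Rightarrow> rvec \<Rightarrow> real"

abbreviation zero_control :: "mamp \<Rightarrow> nat \<Rightarrow> rvec" where
  "zero_control P i \<equiv> 0\<^sub>v (control_dim P i)"

definition state_space :: "mamp \<Rightarrow> nat \<Rightarrow> rvec set" where
  "state_space P i = {x \<in> carrier_vec (state_dim P i). region P i x \<subseteq> workspace P}"

definition free_space :: "mamp \<Rightarrow> nat \<Rightarrow> rvec set" where
  "free_space P i = {x \<in> state_space P i. region P i x \<inter> obstacles P = {}}"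

(* The differential equation may fail at countably many times, so that controls may jump;
   solutions in the strict pointwise sense are the case S = {}. *)
definition satisfies_dynamics :: "mamp \<Rightarrow> nat \<Rightarrow> trajectory \<Rightarrow> bool" where
  "satisfies_dynamics P i p \<longleftrightarrow>
     (\<forall>j<state_dim P i. continuous_on {0..dur p} (\<lambda>t. vec_index (st p t) j)) \<and>
     (\<exists>S. countable S \<and>
        (\<forall>t\<in>{0..dur p} - S. \<forall>j<state_dim P i.
           ((\<lambda>t. vec_index (st p t) j) has_real_derivative
              vec_index (dynamics P i (st p t) (ct p t)) j) (at t within {0..dur p})))"

definition motion_primitive :: "mamp \<Rightarrow> nat \<Rightarrow> trajectory \<Rightarrow> bool" where
  "motion_primitive P i p \<longleftrightarrow>
     0 \<le> dur p \<and>
     (\<forall>t\<in>{0..dur p}. st p t \<in> carrier_vec (state_dim P i) \<and> ct p t \<in> control_set P i) \<and>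
     satisfies_dynamics P i p"

definition at_rest :: "mamp \<Rightarrow> nat \<Rightarrow> bool" where
  "at_rest P i \<longleftrightarrow>
     zero_control P i \<in> control_set P i \<and>
     dynamics P i (init_state P i) (zero_control P i) = 0\<^sub>v (state_dim P i)"

definition mamp_instance :: "mamp \<Rightarrow> bool" where
  "mamp_instance P \<longleftrightarrow>
     1 \<le> num_agents P \<and>
     obstacles P \<subseteq> workspace P \<and>
     (\<forall>i<num_agents P.
        control_set P i \<subseteq> carrier_vec (control_dim P i) \<and>
        (\<forall>x\<in>carrier_vec (state_dim P i). \<forall>u\<in>control_set P i.
           dynamics P i x u \<in> carrier_vec (state_dim P i)) \<and>
        init_state P i \<in> carrier_vec (state_dim P i) \<and>
        final_state P i \<in> carrier_vec (state_dim P i) \<and>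
        at_rest P i \<and>
        (\<forall>p\<in>primitives P i. motion_primitive P i p) \<and>
        (\<forall>x\<in>state_space P i. \<forall>u\<in>control_set P i. 0 \<le> running_cost P x u))"

definition wait :: "mamp \<Rightarrow> nat \<Rightarrow> real \<Rightarrow> trajectory" where
  "wait P i \<tau> =
     \<lparr>dur = \<tau>, st = (\<lambda>_. init_state P i), ct = (\<lambda>_. zero_control P i)\<rparr>"

inductive wait_then_primitives :: "mamp \<Rightarrow> nat \<Rightarrow> trajectory \<Rightarrow> bool" for P i where
  waiting: "0 \<le> \<tau> \<Longrightarrow> wait_then_primitives P i (wait P i \<tau>)"
| append_primitive:
    "wait_then_primitives P i p \<Longrightarrow> q \<in> primitives P i \<Longrightarrow> st p (dur p) = st q 0 \<Longrightarrow>
     wait_then_primitives P i (concatenate p q)"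

definition admissible :: "mamp \<Rightarrow> nat \<Rightarrow> trajectory \<Rightarrow> bool" where
  "admissible P i p \<longleftrightarrow> (\<exists>q. wait_then_primitives P i q \<and> same_trajectory p q)"

(* The integral of a nonnegative function, with value in [0, \<infinity>]. *)
definition trajectory_cost :: "mamp \<Rightarrow> trajectory \<Rightarrow> ennreal" where
  "trajectory_cost P p =
     (\<integral>\<^sup>+t\<in>{0..dur p}. ennreal (running_cost P (st p t) (ct p t)) \<partial>lborel)"

definition feasible_solution ::
    "mamp \<Rightarrow> (nat \<Rightarrow> real \<Rightarrow> rvec) \<times> (nat \<Rightarrow> real \<Rightarrow> rvec) \<times> real \<Rightarrow> bool" where
  "feasible_solution P = (\<lambda>(x, u, t\<^sub>f).
     0 \<le> t\<^sub>f \<and>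
     (\<forall>i<num_agents P.
        admissible P i \<lparr>dur = t\<^sub>f, st = x i, ct = u i\<rparr> \<and>
        x i 0 = init_state P i \<and>
        x i t\<^sub>f = final_state P i \<and>
        (\<forall>t\<in>{0..t\<^sub>f}. x i t \<in> free_space P i)) \<and>
     (\<forall>i<num_agents P. \<forall>j<num_agents P. i \<noteq> j \<longrightarrow>
        (\<forall>t\<in>{0..t\<^sub>f}. region P i (x i t) \<inter> region P j (x j t) = {})))"

definition solution_cost ::
    "mamp \<Rightarrow> (nat \<Rightarrow> real \<Rightarrow> rvec) \<times> (nat \<Rightarrow> real \<Rightarrow> rvec) \<times> real \<Rightarrow> ennreal" where
  "solution_cost P = (\<lambda>(x, u, t\<^sub>f).
     \<Sum>i<num_agents P. trajectory_cost P \<lparr>dur = t\<^sub>f, st = x i, ct = u i\<rparr>)"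

definition optimal_solution ::
    "mamp \<Rightarrow> (nat \<Rightarrow> real \<Rightarrow> rvec) \<times> (nat \<Rightarrow> real \<Rightarrow> rvec) \<times> real \<Rightarrow> bool" where
  "optimal_solution P s \<longleftrightarrow>
     feasible_solution P s \<and>
     (\<forall>s'. feasible_solution P s' \<longrightarrow> solution_cost P s \<le> solution_cost P s')"

definition backward_admissible :: "mamp \<Rightarrow> nat \<Rightarrow> trajectory \<Rightarrow> bool" where
  "backward_admissible P i r \<longleftrightarrow>
     (\<exists>p. admissible P i p \<and> same_trajectory r (time_reversal p))"

definition extended_state :: "mamp \<Rightarrow> nat \<Rightarrow> trajectory \<Rightarrow> real \<Rightarrow> rvec" where
  "extended_state P i r t = (if t \<le> dur r then st r t else init_state P i)"

definition backward_feasible :: "mamp \<Rightarrow> (nat \<Rightarrow> trajectory) \<Rightarrow> bool" where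
  "backward_feasible P r \<longleftrightarrow>
     (\<forall>i<num_agents P.
        0 \<le> dur (r i) \<and>
        backward_admissible P i (r i) \<and>
        st (r i) 0 = final_state P i \<and>
        st (r i) (dur (r i)) = init_state P i \<and>
        (\<forall>t\<in>{0..dur (r i)}. st (r i) t \<in> free_space P i)) \<and>
     (\<forall>i<num_agents P. \<forall>j<num_agents P. i \<noteq> j \<longrightarrow>
        (\<forall>t\<ge>0. region P i (extended_state P i (r i) t) \<inter>
                 region P j (extended_state P j (r j) t) = {}))"

definition backward_cost :: "mamp \<Rightarrow> (nat \<Rightarrow> trajectory) \<Rightarrow> ennreal" where
  "backward_cost P r = (\<Sum>i<num_agents P. trajectory_cost P (r i))"

definition backward_optimal :: "mamp \<Rightarrow> (nat \<Rightarrow> trajectory) \<Rightarrow> bool" where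
  "backward_optimal P r \<longleftrightarrow>
     backward_feasible P r \<and>
     (\<forall>r'. backward_feasible P r' \<longrightarrow> backward_cost P r \<le> backward_cost P r')"

(* An algorithm for the backward problem receives the instance that determines this problem.
   It may return no solution, as it must when the backward problem has none. *)
type_synonym backward_algorithm = "mamp \<Rightarrow> (nat \<Rightarrow> trajectory) option"

definition optimal_algorithm :: "backward_algorithm \<Rightarrow> bool" where
  "optimal_algorithm A \<longleftrightarrow>
     (\<forall>P r. mamp_instance P \<longrightarrow> A P = Some r \<longrightarrow> backward_optimal P r)"

definition simultaneous_arrival ::
    "mamp \<Rightarrow> (nat \<Rightarrow> trajectory) \<Rightarrow>
     (nat \<Rightarrow> real \<Rightarrow> rvec) \<times> (nat \<Rightarrow> real \<Rightarrow> rvec) \<times> real" where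
  "simultaneous_arrival P r =
     (let t\<^sub>f = Max ((\<lambda>i. dur (r i)) ` {..<num_agents P})
      in (\<lambda>i t. if t\<^sub>f - dur (r i) \<le> t then st (r i) (t\<^sub>f - t) else init_state P i,
          \<lambda>i t. if t\<^sub>f - dur (r i) \<le> t then ct (r i) (t\<^sub>f - t) else zero_control P i,
          t\<^sub>f))"

definition SA ::
    "backward_algorithm \<Rightarrow> mamp \<Rightarrow>
     ((nat \<Rightarrow> real \<Rightarrow> rvec) \<times> (nat \<Rightarrow> real \<Rightarrow> rvec) \<times> real) option" where
  "SA A P = map_option (simultaneous_arrival P) (A P)"

end

(* Prefixing every reversed backward trajectory with a wait turns a backward solution into a
   forward one, and the zero-cost hypothesis makes this prefix free; conversely, reversing a
   forward solution gives a backward one whose durations all agree.  Both maps preserve the cost,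
   because Lebesgue measure is invariant under reflections of the line.  The running cost need not
   be measurable, so the integrals are lower integrals, and additivity is never used. *)
theory Submission
  imports Defs
begin

text \<open>For an \<open>f\<close> that may fail to be measurable, the integral is a supremum over
  simple functions below \<open>f\<close>. Each of these is measurable, so affine substitution
  applies to it, and its reflection lies below the reflected \<open>f\<close>.\<close>

lemma nn_integral_lborel_reflect_le:
  fixes f :: "real \<Rightarrow> ennreal"
  shows "(\<integral>\<^sup>+t. f t \<partial>lborel) \<le> (\<integral>\<^sup>+t. f (a - t) \<partial>lborel)"
  unfolding nn_integral_def[of lborel f]
proof (rule SUP_least)
  fix g assume "g \<in> {g. simple_function lborel g \<and> g \<le> f}"
  then have g: "simple_function lborel g" and le: "g \<le> f" by auto
  have meas: "g \<in> borel_measurable borel"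
    using borel_measurable_simple_function[OF g] by simp
  have "integral\<^sup>S lborel g = (\<integral>\<^sup>+t. g t \<partial>lborel)"
    using nn_integral_eq_simple_integral[OF g] by simp
  also have "\<dots> = (\<integral>\<^sup>+t. g (a - t) \<partial>lborel)"
    using nn_integral_real_affine[OF meas, of "-1" a] by simp
  also have "\<dots> \<le> (\<integral>\<^sup>+t. f (a - t) \<partial>lborel)"
    using le by (intro nn_integral_mono) (auto simp: le_fun_def)
  finally show "integral\<^sup>S lborel g \<le> (\<integral>\<^sup>+t. f (a - t) \<partial>lborel)" .
qed

text \<open>A reflection is an involution, so the inequality applied to the reflected function is
  the converse inequality.\<close>

lemma nn_integral_lborel_reflect:
  fixes f :: "real \<Rightarrow> ennreal"
  shows "(\<integral>\<^sup>+t. f (a - t) \<partial>lborel) = (\<integral>\<^sup>+t. f t \<partial>lborel)"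
  using nn_integral_lborel_reflect_le[of f a] nn_integral_lborel_reflect_le[of "\<lambda>t. f (a - t)" a]
  by (intro antisym) auto

lemma trajectory_cost_time_reversal:
  "trajectory_cost P (time_reversal p) = trajectory_cost P p"
  unfolding trajectory_cost_def time_reversal_def
  \<comment> \<open>The reflection about half of \<open>dur p\<close> maps the interval of
    integration onto itself.\<close>
  by (subst nn_integral_lborel_reflect[of _ "dur p", symmetric])
     (auto intro!: nn_integral_cong split: split_indicator)

definition prepend_wait :: "mamp \<Rightarrow> nat \<Rightarrow> real \<Rightarrow> trajectory \<Rightarrow> trajectory" where
  "prepend_wait P i d p = concatenate (wait P i d) p"

lemma prepend_wait_simps [simp]:
  "dur (prepend_wait P i d p) = d + dur p"
  "st (prepend_wait P i d p) t = (if t < d then init_state P i else st p (t - d))"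
  "ct (prepend_wait P i d p) t = (if t < d then zero_control P i else ct p (t - d))"
  by (simp_all add: prepend_wait_def concatenate_def wait_def)

lemma prepend_wait_wait: "prepend_wait P i d (wait P i \<tau>) = wait P i (d + \<tau>)"
  by (auto simp: prepend_wait_def concatenate_def wait_def)

text \<open>If \<open>dur p\<close> were negative, the piece \<open>q\<close> on the right would
  begin before the wait is over, and the two sides could differ.\<close>

lemma prepend_wait_concatenate:
  assumes "0 \<le> dur p"
  shows "prepend_wait P i d (concatenate p q) = concatenate (prepend_wait P i d p) q"
  using assms by (auto simp: prepend_wait_def concatenate_def wait_def fun_eq_iff algebra_simps)

lemma wait_then_primitives_dur_nonneg:
  assumes "wait_then_primitives P i p" and "\<And>q. q \<in> primitives P i \<Longrightarrow> 0 \<le> dur q"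
  shows "0 \<le> dur p"
  using assms by induction (auto simp: wait_def concatenate_def)

text \<open>Induction pushes the new wait inwards past all primitives until it merges with the wait
  at the start.\<close>

lemma wait_then_primitives_prepend_wait:
  assumes "wait_then_primitives P i p" and prim: "\<And>q. q \<in> primitives P i \<Longrightarrow> 0 \<le> dur q"
    and "0 \<le> d"
  shows "wait_then_primitives P i (prepend_wait P i d p)"
  using assms(1)
proof induction
  case (waiting \<tau>)
  then show ?case
    using \<open>0 \<le> d\<close> by (auto simp: prepend_wait_wait intro: wait_then_primitives.waiting)
next
  case (append_primitive p q)
  have "0 \<le> dur p"
    using wait_then_primitives_dur_nonneg[OF append_primitive.hyps(1)] prim by blast
  then show ?case
    using append_primitive
    by (auto simp: prepend_wait_concatenate intro!: wait_then_primitives.append_primitive)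
qed

lemma same_trajectory_prepend_wait:
  assumes "same_trajectory p q"
  shows "same_trajectory (prepend_wait P i d p) (prepend_wait P i d q)"
  using assms by (auto simp: same_trajectory_def)

lemma same_trajectory_time_reversal:
  assumes "same_trajectory p q"
  shows "same_trajectory (time_reversal p) (time_reversal q)"
  using assms by (auto simp: same_trajectory_def time_reversal_def)

lemma time_reversal_time_reversal:
  "same_trajectory (time_reversal (time_reversal p)) p"
  by (simp add: same_trajectory_def time_reversal_def)

lemma same_trajectory_trans:
  assumes "same_trajectory p q" "same_trajectory q r"
  shows "same_trajectory p r"
  using assms by (auto simp: same_trajectory_def)

lemma admissible_same_trajectory:
  assumes "admissible P i q" "same_trajectory p q"
  shows "admissible P i p"
  using assms unfolding admissible_def by (blast intro: same_trajectory_trans)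

lemma admissible_prepend_wait:
  assumes "mamp_instance P" "i < num_agents P" "admissible P i p" "0 \<le> d"
  shows "admissible P i (prepend_wait P i d p)"
proof -
  obtain q where q: "wait_then_primitives P i q" "same_trajectory p q"
    using assms(3) unfolding admissible_def by blast
  have "0 \<le> dur p" if "p \<in> primitives P i" for p
    using assms(1,2) that by (auto simp: mamp_instance_def motion_primitive_def)
  then show ?thesis
    using wait_then_primitives_prepend_wait[OF q(1) _ assms(4)] same_trajectory_prepend_wait[OF q(2)]
    unfolding admissible_def by blast
qed

text \<open>On its interval, \<open>r\<close> agrees with the reversal of an admissible trajectory,
  and reversing once more recovers that trajectory there.\<close>

lemma admissible_time_reversal:
  assumes "backward_admissible P i r"
  shows "admissible P i (time_reversal r)"
  using assms unfolding backward_admissible_def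
  by (blast intro: admissible_same_trajectory same_trajectory_trans
      same_trajectory_time_reversal time_reversal_time_reversal)

text \<open>This is an equality of records, hence valid at all times: at the junction time both
  sides already take the value of the reversed trajectory.\<close>

lemma simultaneous_arrival_eq_prepend_wait:
  assumes "simultaneous_arrival P r = (x, u, t\<^sub>f)"
  shows "\<lparr>dur = t\<^sub>f, st = x i, ct = u i\<rparr>
    = prepend_wait P i (t\<^sub>f - dur (r i)) (time_reversal (r i))"
proof -
  have "x = (\<lambda>i t. if t\<^sub>f - dur (r i) \<le> t then st (r i) (t\<^sub>f - t) else init_state P i)"
    "u = (\<lambda>i t. if t\<^sub>f - dur (r i) \<le> t then ct (r i) (t\<^sub>f - t) else zero_control P i)"
    using assms by (auto simp: simultaneous_arrival_def Let_def)
  then show ?thesis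
    by (simp add: prepend_wait_def concatenate_def wait_def time_reversal_def fun_eq_iff)
qed

lemma simultaneous_arrival_dur_le:
  assumes "simultaneous_arrival P r = (x, u, t\<^sub>f)" "i < num_agents P"
  shows "dur (r i) \<le> t\<^sub>f"
  using assms by (auto simp: simultaneous_arrival_def Let_def intro!: Max_ge)

text \<open>Collision avoidance in the backward problem is phrased with
  \<open>extended_state\<close>, so this form transfers it directly.\<close>

lemma simultaneous_arrival_state:
  assumes "simultaneous_arrival P r = (x, u, t\<^sub>f)"
  shows "x i t = extended_state P i (r i) (t\<^sub>f - t)"
  using assms by (auto simp: simultaneous_arrival_def Let_def extended_state_def)

text \<open>The initial state is the endpoint of a backward trajectory. Its freeness is needed for
  the times spent waiting and for applying the zero-cost hypothesis there.\<close>

lemma backward_feasible_init_state: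
  assumes "backward_feasible P r" "i < num_agents P"
  shows "init_state P i \<in> free_space P i"
proof -
  have "0 \<le> dur (r i)" "st (r i) (dur (r i)) = init_state P i"
    "\<forall>t\<in>{0..dur (r i)}. st (r i) t \<in> free_space P i"
    using assms by (simp_all add: backward_feasible_def)
  then show ?thesis
    by (metis atLeastAtMost_iff order_refl)
qed

lemma feasible_simultaneous_arrival:
  assumes inst: "mamp_instance P" and feas: "backward_feasible P r"
    and sa: "simultaneous_arrival P r = (x, u, t\<^sub>f)"
  shows "feasible_solution P (x, u, t\<^sub>f)"
proof -
  note le = simultaneous_arrival_dur_le[OF sa] and state = simultaneous_arrival_state[OF sa]
  have r: "0 \<le> dur (r i)" "backward_admissible P i (r i)" "st (r i) 0 = final_state P i"
    "st (r i) (dur (r i)) = init_state P i" "\<forall>t\<in>{0..dur (r i)}. st (r i) t \<in> free_space P i"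
    if "i < num_agents P" for i
    using feas that by (auto simp: backward_feasible_def)
  \<comment> \<open>The existence of an agent makes the maximum defining \<open>t\<^sub>f\<close>
    range over a nonempty set.\<close>
  have "0 < num_agents P"
    using inst by (simp add: mamp_instance_def)
  then have "0 \<le> t\<^sub>f"
    using r(1) le by force
  moreover have "admissible P i \<lparr>dur = t\<^sub>f, st = x i, ct = u i\<rparr>" if "i < num_agents P" for i
    unfolding simultaneous_arrival_eq_prepend_wait[OF sa]
    using admissible_prepend_wait[OF inst that admissible_time_reversal] r(2) le that by simp
  moreover have "x i 0 = init_state P i" "x i t\<^sub>f = final_state P i" if "i < num_agents P" for i
    using r[OF that] le[OF that] by (auto simp: state extended_state_def)
  moreover have "x i t \<in> free_space P i" if "i < num_agents P" "t \<in> {0..t\<^sub>f}" for i t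
    using r(5)[OF that(1)] that(2) backward_feasible_init_state[OF feas that(1)]
    by (auto simp: state extended_state_def)
  moreover have "region P i (x i t) \<inter> region P j (x j t) = {}"
    if "i < num_agents P" "j < num_agents P" "i \<noteq> j" "t \<in> {0..t\<^sub>f}" for i j t
    unfolding state using feas that by (simp add: backward_feasible_def)
  ultimately show ?thesis
    by (simp add: feasible_solution_def)
qed

lemma backward_feasible_time_reversal:
  assumes "feasible_solution P (x, u, t\<^sub>f)"
  shows "backward_feasible P (\<lambda>i. time_reversal \<lparr>dur = t\<^sub>f, st = x i, ct = u i\<rparr>)"
proof -
  \<comment> \<open>After backward time \<open>t\<^sub>f\<close> every agent rests at its initial
    state, which is its state at forward time 0. Clamping by \<open>max\<close> thus reduces the
    collision condition at late times to the one at time 0.\<close>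
  have "extended_state P i (time_reversal \<lparr>dur = t\<^sub>f, st = x i, ct = u i\<rparr>) t
      = x i (max 0 (t\<^sub>f - t))" if "i < num_agents P" for i t
    using assms that
    by (auto simp: feasible_solution_def extended_state_def time_reversal_def max_def)
  moreover have "backward_admissible P i (time_reversal \<lparr>dur = t\<^sub>f, st = x i, ct = u i\<rparr>)"
    if "i < num_agents P" for i
    using assms that
    by (auto simp: feasible_solution_def backward_admissible_def same_trajectory_def)
  ultimately show ?thesis
    using assms by (auto simp: backward_feasible_def feasible_solution_def time_reversal_def)
qed

text \<open>The cost of waiting is assumed zero only for \<open>0 < d\<close>, since an empty prefix
  contributes nothing in any case.\<close>

lemma trajectory_cost_prepend_wait:
  assumes "0 < d \<Longrightarrow> ennreal (running_cost P (init_state P i) (zero_control P i)) = 0"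
    and "0 \<le> d"
  shows "trajectory_cost P (prepend_wait P i d p) = trajectory_cost P p"
proof -
  define f where "f t = ennreal (running_cost P (st p t) (ct p t)) * indicator {0..dur p} t" for t
  \<comment> \<open>During the wait the left integrand vanishes by assumption and the right one
    because \<open>t - d\<close> is negative.\<close>
  have "trajectory_cost P (prepend_wait P i d p) = (\<integral>\<^sup>+t. f (t - d) \<partial>lborel)"
    unfolding trajectory_cost_def f_def
    using assms by (intro nn_integral_cong) (auto split: split_indicator)
  also have "\<dots> = (\<integral>\<^sup>+t. f (- t) \<partial>lborel)"
    \<comment> \<open>A translation is a product of two reflections.\<close>
    using nn_integral_lborel_reflect[of "\<lambda>t. f (- t)" d] by simp
  also have "\<dots> = trajectory_cost P p"
    using nn_integral_lborel_reflect[of f 0] by (simp add: trajectory_cost_def f_def)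
  finally show ?thesis .
qed

theorem theorem3:
  fixes A :: backward_algorithm and P :: mamp
    and x u :: "nat \<Rightarrow> real \<Rightarrow> rvec" and t\<^sub>f :: real
  assumes "mamp_instance P"
    and "optimal_algorithm A"
    and "SA A P = Some (x, u, t\<^sub>f)"
    and "\<forall>i<num_agents P. \<forall>s\<in>state_space P i. \<forall>t\<in>{0..t\<^sub>f}.
           (\<integral>\<^sup>+\<tau>\<in>{0..t}. ennreal (running_cost P s (zero_control P i)) \<partial>lborel) = 0"
  shows "optimal_solution P (x, u, t\<^sub>f)"
proof -
  obtain r where "A P = Some r" and sa: "simultaneous_arrival P r = (x, u, t\<^sub>f)"
    using assms(3) by (auto simp: SA_def)
  then have feas: "backward_feasible P r"
    and opt: "backward_feasible P r' \<Longrightarrow> backward_cost P r \<le> backward_cost P r'" for r'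
    using assms(1,2) by (auto simp: optimal_algorithm_def backward_optimal_def)
  have "trajectory_cost P \<lparr>dur = t\<^sub>f, st = x i, ct = u i\<rparr> = trajectory_cost P (r i)"
    if i: "i < num_agents P" for i
  proof -
    have r: "0 \<le> dur (r i)" "dur (r i) \<le> t\<^sub>f"
      using feas i simultaneous_arrival_dur_le[OF sa i] by (auto simp: backward_feasible_def)
    have "init_state P i \<in> state_space P i"
      using backward_feasible_init_state[OF feas i] by (simp add: free_space_def)
    then have "(\<integral>\<^sup>+\<tau>\<in>{0..t\<^sub>f}.
        ennreal (running_cost P (init_state P i) (zero_control P i)) \<partial>lborel) = 0"
      using assms(4) i r by auto
    \<comment> \<open>The integral is this constant times the length of the interval. For
      \<open>t\<^sub>f = 0\<close> it carries no information, but then the prefix is empty.\<close>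
    then have "ennreal (running_cost P (init_state P i) (zero_control P i)) = 0" if "0 < t\<^sub>f"
      using that by (simp add: nn_integral_cmult_indicator)
    then show ?thesis
      unfolding simultaneous_arrival_eq_prepend_wait[OF sa] using r
      by (subst trajectory_cost_prepend_wait) (auto simp: trajectory_cost_time_reversal)
  qed
  then have cost: "solution_cost P (x, u, t\<^sub>f) = backward_cost P r"
    by (simp add: solution_cost_def backward_cost_def)
  have "backward_cost P r \<le> solution_cost P s'" if "feasible_solution P s'" for s'
  proof -
    obtain x' u' t' where s': "s' = (x', u', t')"
      by (cases s')
    show ?thesis
      \<comment> \<open>The competitor in the backward problem is the reversal of \<open>s'\<close>,
        which has the same cost.\<close>
      using opt[OF backward_feasible_time_reversal[OF that[unfolded s']]]
      by (simp add: s' backward_cost_def solution_cost_def trajectory_cost_time_reversal)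
  qed
  with cost show ?thesis
    using feasible_simultaneous_arrival[OF assms(1) feas sa] by (simp add: optimal_solution_def)
qed

end
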